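(* Let $S$ be a set. (1) If $(S,N)$ is a quadratic normalisation of class $(4,3)$, then the restriction $\overline{N}$ of $N$ to the set $S^{[2]}$ of length-two words is idempotent and satisfies $\overline{N}_{212}=\overline{N}_{2121}=\overline{N}_{1212}$ (as maps from $S^{[3]}$ to itself). (2) Conversely, if $\phi:S^{[2]}\to S^{[2]}$ is an idempotent map satisfying $\phi_{212}=\phi_{2121}=\phi_{1212}$ (as maps from $S^{[3]}$ to itself), then there exists a quadratic normalisation $(S,N)$ of class $(4,3)$ such that $\phi=\overline{N}$.
   Context: For a set $S$, $S^*$ is the free monoid of words over $S$, $\|w\|$ is the length of $w$, $u|v$ denotes concatenation, and $S^{[p]}$ is the set of words of length $p$. A normalisation is a pair $(S,N)$ with $S$ a set and $N:S^*\to S^*$ a map such that for all words $u,v,w$: $\|N(w)\|=\|w\|$; $\|w\|=1$ implies $N(w)=w$; and $N(u|N(w)|v)=N(u|w|v)$. A word $w$ is $N$-normal if $N(w)=w$. $\overline{N}$ denotes the restriction of $N$ to $S^{[2]}$. For $\phi:S^{[2]}\to S^{[2]}$ and $i\ge1$, $\phi_i$ is the (partial) map on words that applies $\phi$ to the entries in positions $i,i+1$ and leaves the other entries unchanged. For a finite sequence $u=i_1 i_2\cdots i_n$ of positions, $\phi_u=\phi_{i_n}\circ\cdots\circ\phi_{i_1}$ ($\phi_{i_1}$ is applied first). So $\phi_{212}$ applies $\phi$ in position 2, then 1, then 2. A normalisation $(S,N)$ is quadratic if (a) a word is $N$-normal if and only if each of its length-two factors is $N$-normal, and (b) for every word $w$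 there is a finite sequence $u$ of positions (depending on $w$) with $N(w)=\overline{N}_u(w)$. A quadratic normalisation $(S,N)$ is of class $(4,3)$ if $N(w)=\overline{N}_{1212}(w)$ and $N(w)=\overline{N}_{212}(w)$ for every $w\in S^{[3]}$. *)

theory Defs
  imports Main "HOL-Library.FuncSet" "HOL-Library.Sublist"
begin

text \<open>
  Words over \<open>S\<close> are the elements of \<open>lists S\<close>.  Maps between sets are elements of the
  extensional function space, so that HOL equality of such maps is equality of maps.
\<close>

definition words :: "'a set \<Rightarrow> nat \<Rightarrow> 'a list set" where
  "words S p = {w \<in> lists S. length w = p}"

definition normalisation :: "'a set \<Rightarrow> ('a list \<Rightarrow> 'a list) \<Rightarrow> bool" where
  "normalisation S N \<longleftrightarrow>
     N \<in> lists S \<rightarrow>\<^sub>E lists S \<and>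
     (\<forall>w\<in>lists S. length (N w) = length w) \<and>
     (\<forall>w\<in>lists S. length w = 1 \<longrightarrow> N w = w) \<and>
     (\<forall>u\<in>lists S. \<forall>v\<in>lists S. \<forall>w\<in>lists S. N (u @ N w @ v) = N (u @ w @ v))"

definition normal :: "('a list \<Rightarrow> 'a list) \<Rightarrow> 'a list \<Rightarrow> bool" where
  "normal N w \<longleftrightarrow> N w = w"

definition restr2 :: "'a set \<Rightarrow> ('a list \<Rightarrow> 'a list) \<Rightarrow> 'a list \<Rightarrow> 'a list" where
  "restr2 S N = restrict N (words S 2)"

text \<open>
  Positions are counted from 1.  The map is partial: the result is \<open>None\<close> if the word has no
  entries in positions \<open>i\<close> and \<open>i + 1\<close>.
\<close>

definition apply_at :: "('a list \<Rightarrow> 'a list) \<Rightarrow> nat \<Rightarrow> 'a list \<Rightarrow> 'a list option" where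
  "apply_at \<phi> i w =
     (if 1 \<le> i \<and> i + 1 \<le> length w
      then Some (take (i - 1) w @ \<phi> [w ! (i - 1), w ! i] @ drop (i + 1) w)
      else None)"

text \<open>The leftmost position of the sequence is applied first.\<close>

fun apply_seq :: "('a list \<Rightarrow> 'a list) \<Rightarrow> nat list \<Rightarrow> 'a list \<Rightarrow> 'a list option" where
  "apply_seq \<phi> [] w = Some w"
| "apply_seq \<phi> (i # u) w = Option.bind (apply_at \<phi> i w) (apply_seq \<phi> u)"

definition quadratic :: "'a set \<Rightarrow> ('a list \<Rightarrow> 'a list) \<Rightarrow> bool" where
  "quadratic S N \<longleftrightarrow>
     (\<forall>w\<in>lists S. normal N w \<longleftrightarrow> (\<forall>f. sublist f w \<and> length f = 2 \<longrightarrow> normal N f)) \<and>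
     (\<forall>w\<in>lists S. \<exists>u. apply_seq (restr2 S N) u w = Some (N w))"

definition class_4_3 :: "'a set \<Rightarrow> ('a list \<Rightarrow> 'a list) \<Rightarrow> bool" where
  "class_4_3 S N \<longleftrightarrow>
     (\<forall>w\<in>words S 3. apply_seq (restr2 S N) [1, 2, 1, 2] w = Some (N w) \<and>
                    apply_seq (restr2 S N) [2, 1, 2] w = Some (N w))"

definition idempotent_on :: "'b set \<Rightarrow> ('b \<Rightarrow> 'b) \<Rightarrow> bool" where
  "idempotent_on A f \<longleftrightarrow> (\<forall>x\<in>A. f (f x) = f x)"

definition braid_condition :: "'a set \<Rightarrow> ('a list \<Rightarrow> 'a list) \<Rightarrow> bool" where
  "braid_condition S \<phi> \<longleftrightarrow>
     (\<forall>w\<in>words S 3. apply_seq \<phi> [2, 1, 2] w = apply_seq \<phi> [2, 1, 2, 1] w \<and>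
                    apply_seq \<phi> [2, 1, 2, 1] w = apply_seq \<phi> [1, 2, 1, 2] w)"

text \<open>
  For a map from \<open>words S 2\<close> to itself the three terms in \<open>braid_condition\<close> are never
  \<open>None\<close>, so the equations there are equations between words.
\<close>

lemma apply_at_words:
  assumes "\<phi> \<in> words S 2 \<rightarrow> words S 2" and "w \<in> words S p" and "1 \<le> i" and "i < p"
  shows "\<exists>w'\<in>words S p. apply_at \<phi> i w = Some w'"
proof -
  have w: "set w \<subseteq> S" "length w = p"
    using assms(2) by (auto simp: words_def)
  have "[w ! (i - 1), w ! i] \<in> words S 2"
    using w assms(3,4) by (auto simp: words_def)
  then have "\<phi> [w ! (i - 1), w ! i] \<in> words S 2"
    using assms(1) by blast
  then show ?thesis
    using w assms(3,4)
    by (auto simp: apply_at_def words_def dest: in_set_takeD in_set_dropD)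
qed

lemma apply_seq_words:
  assumes "\<phi> \<in> words S 2 \<rightarrow> words S 2" and "w \<in> words S p" and "set u \<subseteq> {1..<p}"
  shows "\<exists>w'\<in>words S p. apply_seq \<phi> u w = Some w'"
  using assms(2,3)
proof (induction u arbitrary: w)
  case (Cons i u)
  then obtain w' where "w' \<in> words S p" "apply_at \<phi> i w = Some w'"
    using apply_at_words[OF assms(1)] by fastforce
  with Cons show ?case by simp
qed simp

end

theory Submission
  imports Defs
begin

text \<open>
  For part (2), \<open>N\<close> is the iterated left insertion \<open>N(s|w) = s \<cdot> N(w)\<close>, where \<open>s\<close> is inserted into a
  word by applying \<open>\<phi>\<close> at the positions \<open>1, 2, 3, \<dots>\<close> in this order.  The equality
  \<open>\<phi>\<^sub>2\<^sub>1\<^sub>2 = \<phi>\<^sub>2\<^sub>1\<^sub>2\<^sub>1\<close> says that inserting a letter into a word with normal factors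
  creates no factor that is not normal.  The equality \<open>\<phi>\<^sub>2\<^sub>1\<^sub>2 = \<phi>\<^sub>1\<^sub>2\<^sub>1\<^sub>2\<close> makes the insertion
  of \<open>s\<close> after \<open>t\<close> depend on \<open>\<phi>(s|t)\<close> only; hence \<open>N\<close> is invariant under applying \<open>\<phi>\<close> anywhere.
\<close>

section \<open>Factors of length two and sequences of positions\<close>

lemma length_2_conv: "length f = 2 \<longleftrightarrow> (\<exists>a b. f = [a, b])"
  by (auto simp: numeral_2_eq_2 length_Suc_conv)

text \<open>Puts condition (a) of quadraticity into a recursive form, so that normality can be
  followed by induction along a word.\<close>

lemma all_sublist_length_2_iff_successively:
  "(\<forall>f. sublist f w \<and> length f = 2 \<longrightarrow> Q f) \<longleftrightarrow> successively (\<lambda>s t. Q [s, t]) w"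
proof (induction w rule: induct_list012)
  case (3 x y zs)
  have "(\<forall>f. sublist f (x # y # zs) \<and> length f = 2 \<longrightarrow> Q f) \<longleftrightarrow>
      Q [x, y] \<and> (\<forall>f. sublist f (y # zs) \<and> length f = 2 \<longrightarrow> Q f)"
    by (auto simp: sublist_Cons_right[of _ x] length_2_conv)
  then show ?case
    using 3 by simp
qed (auto dest: sublist_length_le)

lemma apply_seq_append:
  "apply_seq \<phi> (u @ v) w = Option.bind (apply_seq \<phi> u w) (apply_seq \<phi> v)"
  by (induction u arbitrary: w) (simp_all split: bind_split)

lemma apply_seq_map_Suc:
  "apply_seq \<phi> u w = Some w' \<Longrightarrow> apply_seq \<phi> (map Suc u) (s # w) = Some (s # w')"
proof (induction u arbitrary: w)
  case (Cons i u)
  then obtain v where v: "apply_at \<phi> i w = Some v" "apply_seq \<phi> u v = Some w'"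
    by (auto simp: bind_eq_Some_conv)
  have "apply_at \<phi> (Suc i) (s # w) = Some (s # v)"
    using v(1) by (cases i) (auto simp: apply_at_def split: if_splits)
  then show ?case
    using Cons.IH[OF v(2)] by simp
qed simp

lemma in_words_2 [simp]: "[s, t] \<in> words S 2 \<longleftrightarrow> s \<in> S \<and> t \<in> S"
  by (simp add: words_def)

lemma words_2E:
  assumes "w \<in> words S 2"
  obtains s t where "w = [s, t]" "s \<in> S" "t \<in> S"
  using assms by (auto simp: words_def length_2_conv)

lemma words_3E:
  assumes "w \<in> words S 3"
  obtains s t r where "w = [s, t, r]" "s \<in> S" "t \<in> S" "r \<in> S"
  using assms by (auto simp: words_def numeral_3_eq_3 length_Suc_conv)

section \<open>The conditions on \<phi>, letter by letter\<close>

locale braided_map =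
  fixes S :: "'a set" and \<phi> :: "'a list \<Rightarrow> 'a list"
  assumes maps: "\<phi> \<in> words S 2 \<rightarrow> words S 2"
    and idem: "idempotent_on (words S 2) \<phi>"
    and braid: "braid_condition S \<phi>"
begin

definition left :: "'a \<Rightarrow> 'a \<Rightarrow> 'a" where "left s t = \<phi> [s, t] ! 0"
definition right :: "'a \<Rightarrow> 'a \<Rightarrow> 'a" where "right s t = \<phi> [s, t] ! 1"

lemma
  assumes "s \<in> S" "t \<in> S"
  shows \<phi>_eq: "\<phi> [s, t] = [left s t, right s t]"
    and left_closed [simp]: "left s t \<in> S"
    and right_closed [simp]: "right s t \<in> S"
proof -
  have "\<phi> [s, t] \<in> words S 2"
    using maps assms by fastforce
  then obtain a b where "\<phi> [s, t] = [a, b]" "a \<in> S" "b \<in> S"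
    by (rule words_2E)
  then show "\<phi> [s, t] = [left s t, right s t]" "left s t \<in> S" "right s t \<in> S"
    by (simp_all add: left_def right_def)
qed

lemma left_right_idem:
  assumes "s \<in> S" "t \<in> S"
  shows "left (left s t) (right s t) = left s t"
    and "right (left s t) (right s t) = right s t"
proof -
  have "\<phi> (\<phi> [s, t]) = \<phi> [s, t]"
    using idem assms by (simp add: idempotent_on_def)
  then show "left (left s t) (right s t) = left s t"
    and "right (left s t) (right s t) = right s t"
    using assms by (simp_all add: \<phi>_eq)
qed

lemma apply_at_3:
  assumes "s \<in> S" "t \<in> S" "r \<in> S"
  shows "apply_at \<phi> 1 [s, t, r] = Some [left s t, right s t, r]"
    and "apply_at \<phi> 2 [s, t, r] = Some [s, left t r, right t r]"
  using assms by (simp_all add: apply_at_def \<phi>_eq)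

text \<open>As \<phi> fixes \<open>[t, r]\<close>, the first step of \<open>[2, 1, 2]\<close> does
  nothing. The other two produce a word that starts with \<open>a\<close>, \<open>c\<close>, and the
  equality with \<open>[2, 1, 2, 1]\<close> says that one more application at position 1 changes
  nothing.\<close>

lemma domino:
  assumes S: "s \<in> S" "t \<in> S" "r \<in> S" and "\<phi> [t, r] = [t, r]"
  defines "a \<equiv> left s t" and "c \<equiv> left (right s t) r"
  shows "\<phi> [a, c] = [a, c]"
proof -
  have "apply_seq \<phi> [2, 1, 2] [s, t, r] = apply_seq \<phi> [2, 1, 2, 1] [s, t, r]"
    using braid S by (auto simp: braid_condition_def words_def)
  moreover have "left t r = t" "right t r = r"
    using assms by (simp_all add: \<phi>_eq)
  ultimately show ?thesis
    using S by (simp add: apply_at_3[unfolded One_nat_def] \<phi>_eq a_def c_def)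
qed

text \<open>Compares the runs of \<open>[1, 2, 1, 2]\<close> and \<open>[2, 1, 2]\<close> on
  \<open>[s, t, r]\<close>. Both end at position 2, so before that step the first letters agree
  already, while the remaining pairs agree only after \<phi>.\<close>

lemma braid_eq:
  assumes S: "s \<in> S" "t \<in> S" "r \<in> S"
  defines "p \<equiv> left t r" and "q \<equiv> right t r"
    and "a \<equiv> left s t" and "b \<equiv> right s t"
  shows "left a (left b r) = left s p"
    and "\<phi> [right a (left b r), right b r] = \<phi> [right s p, q]"
proof -
  have "apply_seq \<phi> [2, 1, 2] [s, t, r] = apply_seq \<phi> [1, 2, 1, 2] [s, t, r]"
    using braid S by (auto simp: braid_condition_def words_def)
  then show "left a (left b r) = left s p"
    and "\<phi> [right a (left b r), right b r] = \<phi> [right s p, q]"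
    using S by (simp_all add: apply_at_3[unfolded One_nat_def] \<phi>_eq assms(4-))
qed

section \<open>Insertion and the map \<open>nf\<close>\<close>

fun insl :: "'a \<Rightarrow> 'a list \<Rightarrow> 'a list" where
  "insl s [] = [s]"
| "insl s (t # w) = left s t # insl (right s t) w"

definition nf :: "'a list \<Rightarrow> 'a list" where
  "nf w = foldr insl w []"

lemma nf_simps [simp]: "nf [] = []" "nf (s # w) = insl s (nf w)"
  by (simp_all add: nf_def)

lemma length_insl [simp]: "length (insl s w) = Suc (length w)"
  by (induction w arbitrary: s) simp_all

lemma insl_closed [simp]: "s \<in> S \<Longrightarrow> set w \<subseteq> S \<Longrightarrow> set (insl s w) \<subseteq> S"
  by (induction w arbitrary: s) simp_all

lemma length_nf [simp]: "length (nf w) = length w"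
  by (induction w) simp_all

lemma nf_closed [simp]: "set w \<subseteq> S \<Longrightarrow> set (nf w) \<subseteq> S"
  by (induction w) simp_all

text \<open>The double insertion moves along \<open>w\<close> by the two sides of
  \<open>braid_eq\<close>: the letters left behind agree, and the pairs carried on have the same
  image under \<phi>. This is the situation at the start, one letter further.\<close>

lemma insl_insl_cong:
  assumes "set w \<subseteq> S" "s \<in> S" "t \<in> S" "s' \<in> S" "t' \<in> S" "\<phi> [s, t] = \<phi> [s', t']"
  shows "insl s (insl t w) = insl s' (insl t' w)"
proof -
  \<comment> \<open>It suffices to replace a pair by its image: two pairs with the same image then
    have the same double insertion.\<close>
  have "insl (left s t) (insl (right s t) w) = insl s (insl t w)" if "s \<in> S" "t \<in> S" for s t
    using that assms(1)
  proof (induction w arbitrary: s t)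
    case Nil
    then show ?case
      by (simp add: left_right_idem)
  next
    case (Cons r w)
    define a where "a = left s t"
    define b where "b = right s t"
    define a1 where "a1 = right a (left b r)"
    define b1 where "b1 = right b r"
    define s1 where "s1 = right s (left t r)"
    define t1 where "t1 = right t r"
    have S: "a1 \<in> S" "b1 \<in> S" "s1 \<in> S" "t1 \<in> S" "set w \<subseteq> S"
      using Cons.prems by (simp_all add: a1_def b1_def s1_def t1_def a_def b_def)
    have "\<phi> [a1, b1] = \<phi> [s1, t1]" and p: "left a (left b r) = left s (left t r)"
      using braid_eq[of s t r] Cons.prems
      by (simp_all add: a1_def b1_def s1_def t1_def a_def b_def)
    then have "left a1 b1 = left s1 t1" "right a1 b1 = right s1 t1"
      using S by (simp_all add: \<phi>_eq)
    \<comment> \<open>The induction hypothesis, used for each of the two pairs, leads to the double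
      insertion of their common image.\<close>
    then have "insl a1 (insl b1 w) = insl s1 (insl t1 w)"
      using Cons.IH[of a1 b1] Cons.IH[of s1 t1] S by simp
    then show ?case
      using p by (simp flip: a_def b_def a1_def b1_def s1_def t1_def)
  qed
  from this[of s t] this[of s' t'] show ?thesis
    using assms by (simp add: \<phi>_eq)
qed

text \<open>Inserting \<open>s\<close> before \<open>t\<close> replaces this pair by its image under
  \<phi>. By idempotence the pair and its image have the same image, so
  \<open>insl_insl_cong\<close> undoes the replacement.\<close>

lemma nf_insl_append:
  assumes "s \<in> S" "set w \<subseteq> S" "set v \<subseteq> S"
  shows "nf (insl s w @ v) = nf (s # w @ v)"
  using assms
proof (induction w arbitrary: s)
  case (Cons t w)
  have "nf (insl s (t # w) @ v) = insl (left s t) (insl (right s t) (nf (w @ v)))"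
    using Cons by simp
  also have "\<dots> = insl s (insl t (nf (w @ v)))"
    using Cons.prems by (intro insl_insl_cong) (simp_all add: \<phi>_eq left_right_idem)
  finally show ?case
    by simp
qed simp

lemma nf_nf_append: "set w \<subseteq> S \<Longrightarrow> set v \<subseteq> S \<Longrightarrow> nf (nf w @ v) = nf (w @ v)"
  by (induction w) (simp_all add: nf_insl_append)

text \<open>As \<open>foldr\<close> works from the right, the prefix \<open>u\<close> acts only on
  \<open>nf\<close> of what follows it, so \<open>nf_nf_append\<close> suffices.\<close>

lemma nf_absorb:
  assumes "set w \<subseteq> S" "set v \<subseteq> S"
  shows "nf (u @ nf w @ v) = nf (u @ w @ v)"
  using nf_nf_append[OF assms] by (simp add: nf_def)

section \<open>Words whose factors of length two are fixed by \<phi>\<close>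

abbreviation locally_normal :: "'a list \<Rightarrow> bool" where
  "locally_normal \<equiv> successively (\<lambda>s t. \<phi> [s, t] = [s, t])"

text \<open>Inserting \<open>s\<close> into \<open>t # r # w\<close> gives a word that starts with
  \<open>left s t\<close>, \<open>left (right s t) r\<close>, a pair fixed by \<open>domino\<close>.
  The rest is the insertion of \<open>right s t\<close> into the shorter word
  \<open>r # w\<close>.\<close>

lemma insl_locally_normal:
  assumes "s \<in> S" "set w \<subseteq> S" "locally_normal w"
  shows "locally_normal (insl s w)"
  using assms
proof (induction w arbitrary: s rule: induct_list012)
  case (2 t)
  then show ?case
    by (simp add: \<phi>_eq left_right_idem)
next
  case (3 t r w)
  have "locally_normal (insl (right s t) (r # w))"
    using 3 by simp
  with 3 show ?case
    by (simp add: domino)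
qed simp

lemma nf_locally_normal: "set w \<subseteq> S \<Longrightarrow> locally_normal (nf w)"
  by (induction w) (simp_all add: insl_locally_normal)

lemma insl_eq_Cons:
  "set (s # w) \<subseteq> S \<Longrightarrow> locally_normal (s # w) \<Longrightarrow> insl s w = s # w"
  by (induction w arbitrary: s) (auto simp: \<phi>_eq)

lemma nf_eq_self: "set w \<subseteq> S \<Longrightarrow> locally_normal w \<Longrightarrow> nf w = w"
proof (induction w)
  case (Cons s w)
  then have "nf w = w"
    by (cases w) simp_all
  with Cons.prems show ?case
    by (simp add: insl_eq_Cons)
qed simp

text \<open>Links the recursion of \<open>insl\<close> with positions: position 1 produces the first
  letter, and the sequence for the tail is shifted by one.\<close>

lemma insl_by_apply_seq:
  assumes "s \<in> S" "set w \<subseteq> S"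
  shows "\<exists>u. apply_seq \<phi> u (s # w) = Some (insl s w)"
  using assms
proof (induction w arbitrary: s)
  case Nil
  have "apply_seq \<phi> [] [s] = Some (insl s [])"
    by simp
  then show ?case ..
next
  case (Cons t w)
  then obtain u where "apply_seq \<phi> u (right s t # w) = Some (insl (right s t) w)"
    by fastforce
  then have "apply_seq \<phi> (1 # map Suc u) (s # t # w) = Some (insl s (t # w))"
    using Cons.prems by (simp add: apply_at_def \<phi>_eq apply_seq_map_Suc)
  then show ?case ..
qed

lemma nf_by_apply_seq:
  assumes "set w \<subseteq> S"
  shows "\<exists>u. apply_seq \<phi> u w = Some (nf w)"
  using assms
proof (induction w)
  case Nil
  have "apply_seq \<phi> [] [] = Some (nf [])"
    by simp
  then show ?case ..
next
  case (Cons s w)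
  then obtain u where "apply_seq \<phi> u w = Some (nf w)"
    by auto
  moreover obtain v where "apply_seq \<phi> v (s # nf w) = Some (insl s (nf w))"
    using insl_by_apply_seq[of s "nf w"] Cons.prems by auto
  \<comment> \<open>The tail is normalised first, one position to the right; then \<open>s\<close>
    is inserted.\<close>
  ultimately have "apply_seq \<phi> (map Suc u @ v) (s # w) = Some (nf (s # w))"
    by (simp add: apply_seq_append apply_seq_map_Suc)
  then show ?case ..
qed

section \<open>The normalisation obtained from \<phi>\<close>

definition normaliser :: "'a list \<Rightarrow> 'a list" where
  "normaliser = restrict nf (lists S)"

lemma normaliser_eq [simp]: "set w \<subseteq> S \<Longrightarrow> normaliser w = nf w"
  by (simp add: normaliser_def lists_eq_set)

lemma normalisation_normaliser: "normalisation S normaliser"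
  unfolding normalisation_def
proof (intro conjI)
  show "normaliser \<in> lists S \<rightarrow>\<^sub>E lists S"
    by (auto simp: normaliser_def lists_eq_set dest: nf_closed)
qed (auto simp: lists_eq_set nf_absorb length_Suc_conv)

context
  assumes ext: "\<phi> \<in> extensional (words S 2)"
begin

text \<open>On two letters \<open>nf\<close> is a single application of \<phi>. Elsewhere equality
  of functions rests on both sides being extensional.\<close>

lemma restr2_normaliser: "restr2 S normaliser = \<phi>"
proof (rule extensionalityI[OF _ ext])
  show "restr2 S normaliser \<in> extensional (words S 2)"
    by (simp add: restr2_def)
  show "restr2 S normaliser w = \<phi> w" if "w \<in> words S 2" for w
    using that by (elim words_2E) (simp add: restr2_def \<phi>_eq)
qed

lemma quadratic_normaliser: "quadratic S normaliser"
  unfolding quadratic_def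
proof (intro conjI ballI)
  fix w assume "w \<in> lists S"
  then have w: "set w \<subseteq> S"
    by auto
  have "normal normaliser w \<longleftrightarrow> locally_normal w"
    using nf_locally_normal[OF w] nf_eq_self[OF w] w by (auto simp: normal_def)
  also have "\<dots> \<longleftrightarrow> successively (\<lambda>s t. normal normaliser [s, t]) w"
    using w by (intro successively_cong) (auto simp: normal_def \<phi>_eq subset_iff)
  also have "\<dots> \<longleftrightarrow> (\<forall>f. sublist f w \<and> length f = 2 \<longrightarrow> normal normaliser f)"
    by (rule all_sublist_length_2_iff_successively[symmetric])
  finally show "normal normaliser w \<longleftrightarrow>
    (\<forall>f. sublist f w \<and> length f = 2 \<longrightarrow> normal normaliser f)" .
  show "\<exists>u. apply_seq (restr2 S normaliser) u w = Some (normaliser w)"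
    using nf_by_apply_seq[OF w] w by (simp add: restr2_normaliser)
qed

lemma class_4_3_normaliser: "class_4_3 S normaliser"
  unfolding class_4_3_def restr2_normaliser
proof (rule ballI)
  fix w assume w: "w \<in> words S 3"
  \<comment> \<open>\<open>nf [s, t, r]\<close> inserts \<open>t\<close> before \<open>r\<close>, at
    position 2, and then \<open>s\<close>, at positions 1 and 2.\<close>
  then have "apply_seq \<phi> [2, 1, 2] w = Some (normaliser w)"
    by (elim words_3E) (simp add: apply_at_3[unfolded One_nat_def])
  moreover have "apply_seq \<phi> [2, 1, 2] w = apply_seq \<phi> [1, 2, 1, 2] w"
    using braid w by (simp add: braid_condition_def)
  ultimately show "apply_seq \<phi> [1, 2, 1, 2] w = Some (normaliser w) \<and>
      apply_seq \<phi> [2, 1, 2] w = Some (normaliser w)"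
    by simp
qed

end

end

section \<open>From a normalisation of class (4,3) to the conditions on its restriction\<close>

lemma normalisation_idem:
  assumes "normalisation S N" "w \<in> lists S"
  shows "N (N w) = N w"
proof -
  have "N ([] @ N w @ []) = N ([] @ w @ [])"
    using assms unfolding normalisation_def by blast
  then show ?thesis
    by simp
qed

lemma restr2_maps:
  assumes "normalisation S N"
  shows "restr2 S N \<in> words S 2 \<rightarrow> words S 2"
  using assms by (auto simp: normalisation_def restr2_def words_def PiE_iff)

lemma restr2_idempotent:
  assumes "normalisation S N"
  shows "idempotent_on (words S 2) (restr2 S N)"
  unfolding idempotent_on_def
proof
  fix w assume w: "w \<in> words S 2"
  then have "restr2 S N w \<in> words S 2"
    using restr2_maps[OF assms] by blast
  then show "restr2 S N (restr2 S N w) = restr2 S N w"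
    using w normalisation_idem[OF assms, of w] by (simp add: restr2_def words_def)
qed

text \<open>The class gives \<open>N w\<close> as the result of both \<open>[2, 1, 2]\<close> and
  \<open>[1, 2, 1, 2]\<close>. A further application at position 1 fixes \<open>N w\<close>, because
  factors of a normal word are normal.\<close>

lemma class_4_3_braid:
  assumes N: "normalisation S N" and q: "quadratic S N" and c: "class_4_3 S N"
  shows "braid_condition S (restr2 S N)"
  unfolding braid_condition_def
proof
  let ?\<phi> = "restr2 S N"
  fix w assume w: "w \<in> words S 3"
  have "N w \<in> words S 3"
    using N w by (auto simp: normalisation_def words_def PiE_iff)
  then obtain s t r where Nw: "N w = [s, t, r]" and S: "s \<in> S" "t \<in> S" "r \<in> S"
    by (rule words_3E)
  have "normal N (N w)"
    using normalisation_idem[OF N, of w] w by (simp add: normal_def words_def)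
  moreover have "N w \<in> lists S" "sublist [s, t] (N w)"
    using Nw S by simp_all
  moreover have "length [s, t] = 2"
    by simp
  ultimately have "normal N [s, t]"
    using q unfolding quadratic_def by blast
  then have "apply_at ?\<phi> 1 (N w) = Some (N w)"
    using Nw S by (simp add: apply_at_def restr2_def normal_def)
  moreover have c': "apply_seq ?\<phi> [1, 2, 1, 2] w = Some (N w)" "apply_seq ?\<phi> [2, 1, 2] w = Some (N w)"
    using c w by (auto simp: class_4_3_def)
  ultimately have "apply_seq ?\<phi> [2, 1, 2, 1] w = Some (N w)"
    using apply_seq_append[of ?\<phi> "[2, 1, 2]" "[1]" w] by simp
  with c' show "apply_seq ?\<phi> [2, 1, 2] w = apply_seq ?\<phi> [2, 1, 2, 1] w \<and>
      apply_seq ?\<phi> [2, 1, 2, 1] w = apply_seq ?\<phi> [1, 2, 1, 2] w"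
    by simp
qed

theorem theoremA:
  fixes S :: "'a set"
  shows "(\<forall>N. normalisation S N \<and> quadratic S N \<and> class_4_3 S N \<longrightarrow>
             idempotent_on (words S 2) (restr2 S N) \<and> braid_condition S (restr2 S N)) \<and>
         (\<forall>\<phi> \<in> words S 2 \<rightarrow>\<^sub>E words S 2.
             idempotent_on (words S 2) \<phi> \<and> braid_condition S \<phi> \<longrightarrow>
             (\<exists>N. normalisation S N \<and> quadratic S N \<and> class_4_3 S N \<and> \<phi> = restr2 S N))"
proof (intro conjI allI ballI impI; (elim conjE)?)
  fix N assume "normalisation S N" "quadratic S N" "class_4_3 S N"
  then show "idempotent_on (words S 2) (restr2 S N)" "braid_condition S (restr2 S N)"
    by (simp_all add: restr2_idempotent class_4_3_braid)
next
  fix \<phi> assume \<phi>: "\<phi> \<in> words S 2 \<rightarrow>\<^sub>E words S 2"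
    and "idempotent_on (words S 2) \<phi>" "braid_condition S \<phi>"
  then interpret braided_map S \<phi>
    by unfold_locales auto
  have "\<phi> \<in> extensional (words S 2)"
    using \<phi> by (simp add: PiE_iff)
  then show "\<exists>N. normalisation S N \<and> quadratic S N \<and> class_4_3 S N \<and> \<phi> = restr2 S N"
    using normalisation_normaliser quadratic_normaliser class_4_3_normaliser restr2_normaliser
    by metis
qed

end
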